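(* Assume that $\mathbb{S}(\Omega)\subset\Omega$. If $a\in\{0,1\}$ and $\beta\in M_a\cup\{\eta\}$ are such that $\{a^s\beta,a^t\beta\}\subset\Omega$ for some nonnegative integers $s,t$ with $\gcd(s-t,q-1)=1$, then the girth of $\Gamma(\Omega,q)$ is at least $2(|\beta|+3)$.
   Context: Let $q$ be a prime power and $\mathbb{F}_q$ the field with $q$ elements. $\{0,1\}^*$ is the set of finite binary sequences, $\eta$ the null sequence; juxtaposition is concatenation; $|\beta|$ is the length of $\beta$; $\alpha^i$ is the $i$-fold concatenation of $\alpha$ ($\alpha^0=\eta$). $\Omega\subset\{0,1\}^*$ is a finite set satisfying condition C1: $\eta\in\Omega$, and for any $\alpha\in\Omega\setminus\{\eta\}$ the sequence obtained by deleting the last bit of $\alpha$ is in $\Omega$. $L(\Omega)$ and $R(\Omega)$ are two disjoint copies of $\mathbb{F}_q^{|\Omega|+1}$; their vectors are written $[l]$ and $\langle r\rangle$ respectively, with entries indexed by $\Omega\cup\{*\}$, where $*\notin\Omega$ is an extra symbol. $\Gamma(\Omega,q)$ is the bipartite graph with vertex set $L(\Omega)\cup R(\Omega)$ in which $[l]\in L(\Omega)$ and $\langle r\rangle\in R(\Omega)$ are adjacent if and only if $l_\eta+r_\eta=l_*r_*$, $l_{\alpha0}+r_{\alpha0}=r_*l_\alpha$ for all $\alpha0\in\Omega$, and $l_{\beta1}+r_{\beta1}=l_*r_\beta$ for all $\beta1\in\Omega$ (here $\alpha,\beta\in\{0,1\}^*$). For $\alpha\in\Omega$, $S_\Omega(\alpha)$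 is the set of $\beta\in\{0,1\}^*$ with $\{\alpha01\beta,\alpha10\beta\}\cap\Omega\ne\emptyset$, and $\mathbb{S}(\Omega)=\bigcup_{\alpha\in\Omega}S_\Omega(\alpha)$. $M_0=\{0,01,010,0101,\ldots\}$ and $M_1=\{1,10,101,1010,\ldots\}$ are the sets of nonempty alternating binary sequences with first bit $0$, respectively $1$. *)

theory Defs
  imports "Graph_Theory.Graph_Theory" "HOL-Library.Extended_Nat" "HOL-Library.Cardinality" "HOL-Library.FuncSet"
begin

text \<open>
  Binary sequences are lists of Booleans: \<^term>\<open>False\<close> is the bit 0, \<^term>\<open>True\<close> is the
  bit 1, and \<^term>\<open>[]\<close> is the null sequence. In the index set of the vectors,
  \<^term>\<open>None\<close> is the extra symbol \<open>*\<close>.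
\<close>

type_synonym bits = "bool list"
type_synonym 'a bvec = "bits option \<Rightarrow> 'a"
type_synonym 'a vertex = "'a bvec + 'a bvec"

definition C1 :: "bits set \<Rightarrow> bool" where
  "C1 \<Omega> \<longleftrightarrow> [] \<in> \<Omega> \<and> (\<forall>\<alpha> \<in> \<Omega> - {[]}. butlast \<alpha> \<in> \<Omega>)"

definition idx :: "bits set \<Rightarrow> bits option set" where
  "idx \<Omega> = insert None (Some ` \<Omega>)"

text \<open>Vectors are extensional functions, so that each vector is represented exactly once.\<close>

definition vecs :: "bits set \<Rightarrow> 'a bvec set" where
  "vecs \<Omega> = (idx \<Omega> \<rightarrow>\<^sub>E UNIV)"

definition L_verts :: "bits set \<Rightarrow> 'a vertex set" where
  "L_verts \<Omega> = Inl ` vecs \<Omega>"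

definition R_verts :: "bits set \<Rightarrow> 'a vertex set" where
  "R_verts \<Omega> = Inr ` vecs \<Omega>"

definition incident :: "bits set \<Rightarrow> 'a::field bvec \<Rightarrow> 'a bvec \<Rightarrow> bool" where
  "incident \<Omega> l r \<longleftrightarrow>
     l (Some []) + r (Some []) = l None * r None \<and>
     (\<forall>\<alpha>. \<alpha> @ [False] \<in> \<Omega> \<longrightarrow>
        l (Some (\<alpha> @ [False])) + r (Some (\<alpha> @ [False])) = r None * l (Some \<alpha>)) \<and>
     (\<forall>\<beta>. \<beta> @ [True] \<in> \<Omega> \<longrightarrow>
        l (Some (\<beta> @ [True])) + r (Some (\<beta> @ [True])) = l None * r (Some \<beta>))"

text \<open>
  An undirected edge is represented by its two orientations; the field is the type
  \<open>'a\<close>, so that \<open>q\<close> is \<open>CARD('a)\<close>.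
\<close>

definition Gamma :: "bits set \<Rightarrow> 'a::field vertex pair_pre_digraph" where
  "Gamma \<Omega> =
     \<lparr> pverts = L_verts \<Omega> \<union> R_verts \<Omega>,
       parcs = (\<Union>l \<in> vecs \<Omega>. \<Union>r \<in> {r \<in> vecs \<Omega>. incident \<Omega> l r}.
                  {(Inl l, Inr r), (Inr r, Inl l)}) \<rparr>"

lemma pair_graph_Gamma:
  assumes "finite \<Omega>"
  shows "pair_graph (Gamma \<Omega> :: 'a::{field,finite} vertex pair_pre_digraph)"
proof -
  have V: "finite (vecs \<Omega> :: 'a bvec set)"
    unfolding vecs_def idx_def using assms by (intro finite_PiE) auto
  have P: "finite (pverts (Gamma \<Omega> :: 'a vertex pair_pre_digraph))"
    using V by (simp add: Gamma_def L_verts_def R_verts_def)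
  have E: "parcs (Gamma \<Omega> :: 'a vertex pair_pre_digraph) \<subseteq> pverts (Gamma \<Omega>) \<times> pverts (Gamma \<Omega>)"
    by (auto simp: Gamma_def L_verts_def R_verts_def)
  have F: "finite (parcs (Gamma \<Omega> :: 'a vertex pair_pre_digraph))"
    using E P by (meson finite_SigmaI finite_subset)
  have S: "sym (parcs (Gamma \<Omega> :: 'a vertex pair_pre_digraph))"
    by (auto simp: Gamma_def sym_def)
  show ?thesis
    apply unfold_locales
    using P F E S by (auto simp: symmetric_def arcs_ends_def arc_to_ends_def Gamma_def L_verts_def R_verts_def)
qed

text \<open>
  The girth of a graph without cycles is \<open>\<infinity>\<close>. The library's \<open>cycle\<close> also covers the closed
  walk that traverses an edge and its reverse, hence the bound on the length.
\<close>

definition girth :: "'v pair_pre_digraph \<Rightarrow> enat" where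
  "girth G = (INF p \<in> {p. pre_digraph.cycle (with_proj G) p \<and> 3 \<le> length p}. enat (length p))"

definition S_at :: "bits set \<Rightarrow> bits \<Rightarrow> bits set" where
  "S_at \<Omega> \<alpha> = {\<beta>. {\<alpha> @ [False, True] @ \<beta>, \<alpha> @ [True, False] @ \<beta>} \<inter> \<Omega> \<noteq> {}}"

definition S_all :: "bits set \<Rightarrow> bits set" where
  "S_all \<Omega> = (\<Union>\<alpha> \<in> \<Omega>. S_at \<Omega> \<alpha>)"

definition M :: "bool \<Rightarrow> bits set" where
  "M a = {\<beta>. \<beta> \<noteq> [] \<and> hd \<beta> = a \<and> distinct_adj \<beta>}"

end

theory Submission
  imports Defs
begin

text \<open>
  Call the entry \<open>*\<close> of a vertex its colour. A neighbour of a vertex is determined by its colour,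
  so on a cycle the colours of vertices two apart differ. Suppose that a cycle has length \<open>2m\<close> with
  \<open>m \<le> length \<beta> + 2\<close>. Since \<open>\<Omega>\<close> is closed under prefixes, \<open>\<beta>\<close> may be
  shortened until \<open>m = length \<beta> + 2\<close>. Start at a vertex \<open>v\<^sub>0\<close> of the cycle, on the left if \<open>a\<close> is the bit 0
  and on the right otherwise, and write \<open>c\<^sub>i\<close> for the colour of the \<open>i\<close>-th vertex \<open>v\<^sub>i\<close>.

  The condition on \<open>S_all \<Omega>\<close> provides automorphisms that keep all colours and can shift the entry at any
  chosen word of \<open>\<Omega>\<close> (\<open>adj_translate\<close>); composing them one may assume that all entries of \<open>v\<^sub>0\<close> other than its
  colour vanish (\<open>ex_normalizing_automorphism\<close>). Subtracting the equations of two successive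
  edges \<open>v\<^sub>i v\<^sub>i\<^sub>+\<^sub>1\<close> and \<open>v\<^sub>i\<^sub>+\<^sub>1 v\<^sub>i\<^sub>+\<^sub>2\<close> shows that the entry at a word \<open>w\<close> followed by one bit changes by either
  \<open>c\<^sub>i\<^sub>+\<^sub>2 - c\<^sub>i\<close> times the \<open>w\<close>-entry of \<open>v\<^sub>i\<^sub>+\<^sub>1\<close>, or \<open>c\<^sub>i\<^sub>+\<^sub>1\<close> times the change of the \<open>w\<close>-entry, depending on
  the bit (\<open>two_steps\<close>). The change of the entry at the null word is \<open>(c\<^sub>i\<^sub>+\<^sub>2 - c\<^sub>i)c\<^sub>i\<^sub>+\<^sub>1\<close>. The second rule,
  used \<open>s\<close> times on it for \<open>i = 0\<close>, gives the factor \<open>c\<^sub>1\<^sup>s\<^sup>+\<^sup>1\<close>. The first one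
  moves along the alternating word \<open>\<beta>\<close> in step with the walk: a nonzero entry travels exactly one
  bit per edge and picks up one colour difference. Hence the entry of \<open>v\<^sub>m\<close> at
  \<open>a\<^sup>s\<beta>\<close> is \<open>c\<^sub>1\<^sup>s\<^sup>+\<^sup>1 P\<close>, where \<open>P\<close> is the product of the differences \<open>c\<^sub>i\<^sub>+\<^sub>2 - c\<^sub>i\<close> (\<open>walk_prefix_word\<close>).

  The opposite vertex \<open>v\<^sub>m\<close> is reached in \<open>m\<close> steps in the other direction, too, with first colour
  \<open>c'\<close> and a product \<open>Q\<close>. So \<open>c\<^sub>1\<^sup>s\<^sup>+\<^sup>1 P = c'\<^sup>s\<^sup>+\<^sup>1 Q\<close>, and likewise for \<open>t\<close>, with \<open>P\<close> and \<open>Q\<close> nonzero. If one of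
  \<open>c\<^sub>1\<close> and \<open>c'\<close> is zero, then so is the other; otherwise the order of \<open>c\<^sub>1 / c'\<close> divides both \<open>s - t\<close> and
  \<open>q - 1\<close>. In both cases \<open>c\<^sub>1 = c'\<close>, although these are the colours of the two neighbours of \<open>v\<^sub>0\<close> on the
  cycle.
\<close>

section \<open>Incidence seen from either side\<close>

text \<open>
  The graph is symmetric under exchanging the two sides together with the two bits. In
  \<open>adj b\<close> the first vertex lies on the right if \<open>b\<close> holds and on the left otherwise, which
  lets each argument cover both sides at once.
\<close>

definition adj :: "bool \<Rightarrow> bits set \<Rightarrow> 'a::field bvec \<Rightarrow> 'a bvec \<Rightarrow> bool" where
  "adj b \<Omega> p q \<longleftrightarrow>
     p (Some []) + q (Some []) = p None * q None \<and>
     (\<forall>w. w @ [b] \<in> \<Omega> \<longrightarrow> p (Some (w @ [b])) + q (Some (w @ [b])) = q None * p (Some w)) \<and>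
     (\<forall>w. w @ [\<not> b] \<in> \<Omega> \<longrightarrow> p (Some (w @ [\<not> b])) + q (Some (w @ [\<not> b])) = p None * q (Some w))"

lemma adj_False: "adj False \<Omega> l r = incident \<Omega> l r"
  by (simp add: adj_def incident_def)

lemma adj_swap: "adj (\<not> b) \<Omega> q p = adj b \<Omega> p q"
  unfolding adj_def by (auto simp: add.commute mult.commute)

lemma prefix_in_if_C1:
  assumes "C1 \<Omega>" "v @ w \<in> \<Omega>"
  shows "v \<in> \<Omega>"
  using assms(2)
proof (induction w rule: rev_induct)
  case (snoc x w)
  have "butlast (v @ w @ [x]) \<in> \<Omega>"
    using assms(1) snoc.prems unfolding C1_def by blast
  then show ?case
    using snoc.IH by (simp add: butlast_append)
qed simp

text \<open>
  Each equation expresses an entry of \<open>q\<close> through \<open>p\<close>, the colour of \<open>q\<close>, and at most one entry of \<open>q\<close>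
  at a shorter word.
\<close>

lemma neighbour_determined_by_colour:
  assumes "C1 \<Omega>" "adj b \<Omega> p q" "adj b \<Omega> p q'" "q None = q' None" "w \<in> \<Omega>"
  shows "q (Some w) = q' (Some w)"
  using assms(5)
proof (induction w rule: rev_induct)
  case Nil
  have "p (Some []) + q (Some []) = p (Some []) + q' (Some [])"
    using assms(2-4) by (simp add: adj_def)
  then show ?case by simp
next
  case (snoc e w)
  then have IH: "q (Some w) = q' (Some w)"
    using prefix_in_if_C1[OF assms(1)] by blast
  have "p (Some (w @ [e])) + q (Some (w @ [e])) = p (Some (w @ [e])) + q' (Some (w @ [e]))"
    using assms(2-4) IH snoc.prems unfolding adj_def by (cases "e = b") auto
  then show ?case by simp
qed

section \<open>Translations\<close>

definition sg :: "bool \<Rightarrow> 'a::field" where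
  "sg e = (if e then -1 else 1)"

lemma sg_Not [simp]: "sg (\<not> e) = - sg e"
  by (simp add: sg_def)

text \<open>
  \<open>drift\<close> is the first-order response to raising the entry of a left vertex at a word \<open>\<alpha>\<close> by
  one and lowering that of its right neighbours. It is indexed by what follows \<open>\<alpha>\<close>. The change is
  visible at \<open>\<alpha>0\<close> and \<open>\<alpha>1\<close> as a multiple of the colour, and from \<open>\<alpha>01\<close> and \<open>\<alpha>10\<close> on it reproduces, up to
  sign, the vertex itself: the common factor there is the product of both colours, which is what
  the equation at the null word can absorb.
\<close>

fun drift :: "bool \<Rightarrow> 'a::field bvec \<Rightarrow> bits \<Rightarrow> 'a" where
  "drift b p [] = sg b"
| "drift b p [e] = (if e = b then 0 else sg e * p None)"
| "drift b p (e # f # v) = (if e = f then 0 else sg e * p (Some v))"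

text \<open>
  The drifts solve the same linear recursion as the entries. After one of the prefixes 01 and 10
  this is the adjacency equation at a shorter word, which is available only if that word belongs
  to \<open>\<Omega>\<close>; this is where the condition on \<open>S_all \<Omega>\<close> enters.
\<close>

lemma drift_snoc:
  assumes adj: "adj b \<Omega> p q"
    and mem: "\<And>e f u. v @ [b] = e # f # u \<Longrightarrow> e \<noteq> f \<Longrightarrow> u \<in> \<Omega> \<or> u = []"
  shows "drift b p (v @ [b]) + drift (\<not> b) q (v @ [b]) = q None * drift b p v"
proof (cases "(b, p, v)" rule: drift.cases)
  case (1 b' p')
  then show ?thesis by (simp add: sg_def)
next
  case (2 b' p' e)
  have "sg e * p (Some []) + sg e * q (Some []) = sg e * (p None * q None)"
    using adj by (simp add: adj_def flip: distrib_left)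
  then show ?thesis using 2 by (auto simp: sg_def mult_ac)
next
  case (3 b' p' e f u)
  show ?thesis
  proof (cases "e = f")
    case False
    then have "u @ [b] \<in> \<Omega>"
      using mem 3 by auto
    then have "sg e * p (Some (u @ [b])) + sg e * q (Some (u @ [b])) = sg e * (q None * p (Some u))"
      using adj by (simp add: adj_def flip: distrib_left)
    then show ?thesis using 3 False by (simp add: mult_ac)
  qed (use 3 in simp)
qed

definition translate :: "bits \<Rightarrow> 'a::field \<Rightarrow> bool \<Rightarrow> 'a bvec \<Rightarrow> 'a bvec" where
  "translate \<alpha> c b p i = (case i of
     None \<Rightarrow> p None
   | Some w \<Rightarrow> p (Some w) +
       (if take (length \<alpha>) w = \<alpha> then c * drift b p (drop (length \<alpha>) w) else 0))"

lemma translate_None [simp]: "translate \<alpha> c b p None = p None"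
  by (simp add: translate_def)

lemma translate_extension:
  "translate \<alpha> c b p (Some (\<alpha> @ v)) = p (Some (\<alpha> @ v)) + c * drift b p v"
  by (simp add: translate_def)

lemma translate_other:
  "(\<And>v. w \<noteq> \<alpha> @ v) \<Longrightarrow> translate \<alpha> c b p (Some w) = p (Some w)"
  unfolding translate_def by (auto, metis append_take_drop_id)

lemma translate_snoc:
  assumes "S_all \<Omega> \<subseteq> \<Omega>" "\<alpha> \<in> \<Omega>" "adj b \<Omega> p q" "w @ [b] \<in> \<Omega>"
  shows "translate \<alpha> c b p (Some (w @ [b])) + translate \<alpha> c (\<not> b) q (Some (w @ [b]))
         = q None * translate \<alpha> c b p (Some w)"
proof -
  have eq: "p (Some (w @ [b])) + q (Some (w @ [b])) = q None * p (Some w)"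
    using assms(3,4) by (simp add: adj_def)
  consider (ext) v where "w = \<alpha> @ v" | (new) "w @ [b] = \<alpha>" "\<And>v. w \<noteq> \<alpha> @ v"
    | (other) "\<And>v. w \<noteq> \<alpha> @ v" "\<And>v. w @ [b] \<noteq> \<alpha> @ v"
    by (metis append.right_neutral append_assoc butlast_append butlast_snoc)
  then show ?thesis
  proof cases
    case ext
    have "drift b p (v @ [b]) + drift (\<not> b) q (v @ [b]) = q None * drift b p v"
    proof (rule drift_snoc[OF assms(3)])
      fix e f u assume "v @ [b] = e # f # u" "e \<noteq> f"
      then have "u \<in> S_at \<Omega> \<alpha>"
        using assms(4) ext unfolding S_at_def by (cases e; cases f) auto
      then show "u \<in> \<Omega> \<or> u = []"
        using assms(1,2) by (auto simp: S_all_def)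
    qed
    then have "c * drift b p (v @ [b]) + c * drift (\<not> b) q (v @ [b]) = q None * (c * drift b p v)"
      by (metis distrib_left mult.left_commute)
    then show ?thesis
      using eq ext translate_extension[of \<alpha> c _ _ "v @ [b]"] translate_extension[of \<alpha> c _ _ v]
      by (simp add: algebra_simps)
  next
    case new
    then show ?thesis
      using eq translate_extension[of \<alpha> c _ _ "[]"] translate_other[OF new(2), of c]
      by (simp add: algebra_simps)
  next
    case other
    then show ?thesis using eq by (simp add: translate_other)
  qed
qed

lemma adj_translate:
  assumes "S_all \<Omega> \<subseteq> \<Omega>" "\<alpha> \<in> \<Omega>" "adj b \<Omega> p q"
  shows "adj b \<Omega> (translate \<alpha> c b p) (translate \<alpha> c (\<not> b) q)"
proof -
  have "translate \<alpha> c b p (Some []) + translate \<alpha> c (\<not> b) q (Some []) = p None * q None"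
    using assms(3) by (cases "\<alpha> = []") (auto simp: translate_def adj_def)
  moreover have "adj (\<not> b) \<Omega> q p"
    using assms(3) by (simp add: adj_swap)
  ultimately show ?thesis
    using translate_snoc[OF assms, of _ c] translate_snoc[OF assms(1,2), of "\<not> b" q p _ c]
    by (simp add: adj_def add.commute)
qed

text \<open>
  A translation at \<open>\<alpha>\<close> changes only entries at extensions of \<open>\<alpha>\<close>. Treating the words by increasing
  length therefore keeps the entries that have already been cleared.
\<close>

lemma ex_normalizing_automorphism:
  assumes "finite \<Omega>" "S_all \<Omega> \<subseteq> \<Omega>"
  shows "\<exists>\<phi>. (\<forall>b p. \<phi> b p None = p None) \<and>
             (\<forall>b p q. adj b \<Omega> p q \<longrightarrow> adj b \<Omega> (\<phi> b p) (\<phi> (\<not> b) q)) \<and>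
             (\<forall>w\<in>\<Omega>. \<phi> a (p\<^sub>0 :: 'a::field bvec) (Some w) = 0)"
proof -
  have "A \<subseteq> \<Omega> \<Longrightarrow> \<exists>\<phi>. (\<forall>b p. \<phi> b p None = p None) \<and>
             (\<forall>b p q. adj b \<Omega> p q \<longrightarrow> adj b \<Omega> (\<phi> b p) (\<phi> (\<not> b) q)) \<and>
             (\<forall>w\<in>A. \<phi> a p\<^sub>0 (Some w) = 0)" if "finite A" for A
    using that
  proof (induction A rule: finite_ranking_induct[where f = length])
    case empty
    show ?case by (rule exI[of _ "\<lambda>b p. p"]) simp
  next
    case (insert \<alpha> A)
    then obtain \<phi> where \<phi>: "\<And>b p. \<phi> b p None = p None"
      "\<And>b p q. adj b \<Omega> p q \<Longrightarrow> adj b \<Omega> (\<phi> b p) (\<phi> (\<not> b) q)"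
      "\<And>w. w \<in> A \<Longrightarrow> \<phi> a p\<^sub>0 (Some w) = 0"
      by blast
    \<comment> \<open>The drift at \<open>\<alpha>\<close> itself is the sign of the side, which is its own inverse.\<close>
    define c where "c = - sg a * \<phi> a p\<^sub>0 (Some \<alpha>)"
    have "sg a * sg a = (1 :: 'a)" by (simp add: sg_def)
    then have at: "translate \<alpha> c a (\<phi> a p\<^sub>0) (Some \<alpha>) = 0"
      using translate_extension[of \<alpha> c a "\<phi> a p\<^sub>0" "[]"] by (simp add: c_def mult_ac)
    have old: "translate \<alpha> c a (\<phi> a p\<^sub>0) (Some w) = 0" if "w \<in> A" for w
    proof (cases "w = \<alpha>")
      case False
      then have "w \<noteq> \<alpha> @ v" for v
        using insert.hyps(2)[OF that] by auto
      then show ?thesis using \<phi>(3)[OF that] by (simp add: translate_other)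
    qed (simp add: at)
    show ?case
    proof (intro exI[of _ "\<lambda>b p. translate \<alpha> c b (\<phi> b p)"] conjI allI impI ballI)
      fix b and p q :: "'a bvec" assume "adj b \<Omega> p q"
      then show "adj b \<Omega> (translate \<alpha> c b (\<phi> b p)) (translate \<alpha> c (\<not> b) (\<phi> (\<not> b) q))"
        using adj_translate[OF assms(2)] \<phi>(2) insert.prems by blast
    qed (use \<phi>(1) at old in auto)
  qed
  then show ?thesis using assms(1) by blast
qed

section \<open>Walks\<close>

text \<open>
  The first vertex of a walk lies on the side for which its entries at \<open>w\<close> followed by \<open>a\<close> are governed by
  the colour of the neighbour.
\<close>

definition walk :: "bool \<Rightarrow> bits set \<Rightarrow> (nat \<Rightarrow> 'a::field bvec) \<Rightarrow> nat \<Rightarrow> bool" where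
  "walk a \<Omega> v n \<longleftrightarrow> (\<forall>i<n. adj (even i = a) \<Omega> (v i) (v (Suc i)))"

lemma walk_rev:
  assumes "walk a \<Omega> v n" "even n"
  shows "walk a \<Omega> (\<lambda>i. v (n - i)) n"
  unfolding walk_def
proof (intro allI impI)
  fix i assume "i < n"
  then have "adj (even (n - Suc i) = a) \<Omega> (v (n - Suc i)) (v (Suc (n - Suc i)))"
  proof -
    have "n - Suc i < n" using \<open>i < n\<close> by simp
    then show ?thesis using assms(1) unfolding walk_def by blast
  qed
  moreover have "(even (n - Suc i) = a) = (\<not> (even i = a))" "Suc (n - Suc i) = n - i"
    using \<open>i < n\<close> assms(2) by auto
  ultimately show "adj (even i = a) \<Omega> (v (n - i)) (v (n - Suc i))"
    by (simp only: adj_swap)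
qed

text \<open>
  Both outer vertices are adjacent to the middle one; subtracting the two equations at a word
  cancels the entry of the middle vertex there.
\<close>

lemma two_steps:
  assumes "walk a \<Omega> v n" "Suc (Suc i) \<le> n"
  shows two_steps_Nil: "v (Suc (Suc i)) (Some []) - v i (Some [])
           = (v (Suc (Suc i)) None - v i None) * v (Suc i) None"
    and two_steps_same: "e = (even i \<noteq> a) \<Longrightarrow> w @ [e] \<in> \<Omega> \<Longrightarrow>
           v (Suc (Suc i)) (Some (w @ [e])) - v i (Some (w @ [e]))
           = (v (Suc (Suc i)) None - v i None) * v (Suc i) (Some w)"
    and two_steps_opposite: "e = (even i = a) \<Longrightarrow> w @ [e] \<in> \<Omega> \<Longrightarrow>
           v (Suc (Suc i)) (Some (w @ [e])) - v i (Some (w @ [e]))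
           = v (Suc i) None * (v (Suc (Suc i)) (Some w) - v i (Some w))"
proof -
  define b where "b = (even i = a)"
  have 1: "adj b \<Omega> (v i) (v (Suc i))"
    using assms by (auto simp: walk_def b_def)
  have "adj (even (Suc i) = a) \<Omega> (v (Suc i)) (v (Suc (Suc i)))"
    using assms unfolding walk_def by (meson Suc_le_lessD)
  moreover have "(even (Suc i) = a) = (\<not> b)"
    by (auto simp: b_def)
  ultimately have 2: "adj b \<Omega> (v (Suc (Suc i))) (v (Suc i))"
    by (simp only: adj_swap)
  have diff: "r - p = x - y" if "p + q = y" "r + q = x" for p q r x y :: 'a
    using that by (auto simp: algebra_simps)
  show "v (Suc (Suc i)) (Some []) - v i (Some [])
           = (v (Suc (Suc i)) None - v i None) * v (Suc i) None"
    using 1 2 unfolding adj_def left_diff_distrib by (intro diff) auto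
  show "v (Suc (Suc i)) (Some (w @ [e])) - v i (Some (w @ [e]))
           = (v (Suc (Suc i)) None - v i None) * v (Suc i) (Some w)"
    if "e = (even i \<noteq> a)" "w @ [e] \<in> \<Omega>"
  proof -
    have "e = (\<not> b)" using that(1) by (simp add: b_def)
    then show ?thesis
      using 1 2 that(2) unfolding adj_def left_diff_distrib by (intro diff) auto
  qed
  show "v (Suc (Suc i)) (Some (w @ [e])) - v i (Some (w @ [e]))
           = v (Suc i) None * (v (Suc (Suc i)) (Some w) - v i (Some w))"
    if "e = (even i = a)" "w @ [e] \<in> \<Omega>"
  proof -
    have "e = b" using that(1) by (simp add: b_def)
    then show ?thesis
      using 1 2 that(2) unfolding adj_def right_diff_distrib by (intro diff) auto
  qed
qed

lemma walk_constant_word: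
  assumes "C1 \<Omega>" "walk a \<Omega> v n" "2 \<le> n" "replicate s a \<in> \<Omega>"
  shows "v 2 (Some (replicate s a)) - v 0 (Some (replicate s a))
         = v 1 None ^ Suc s * (v 2 None - v 0 None)"
  using assms(4)
proof (induction s)
  case 0
  then show ?case
    using two_steps_Nil[OF assms(2), of 0] assms(3) by (simp add: numeral_2_eq_2 mult.commute)
next
  case (Suc s)
  have eq: "replicate (Suc s) a = replicate s a @ [a]"
    by (simp add: replicate_append_same)
  then have "replicate s a \<in> \<Omega>"
    using Suc.prems prefix_in_if_C1[OF assms(1)] by metis
  from Suc.IH[OF this] show ?case
    using two_steps_opposite[OF assms(2), of 0 a "replicate s a"] assms(3) Suc.prems
    unfolding eq by (simp add: numeral_2_eq_2 mult_ac)
qed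

text \<open>
  From here on the word under consideration is the prefix \<open>a\<^sup>s\<beta>\<^sub>1...\<beta>\<^sub>j\<close>. As \<open>\<beta>\<close> alternates
  from \<open>a\<close> on, each of its bits is, at the vertices of matching parity, the one whose equation relates an entry
  to a colour difference.
\<close>

context
  fixes \<Omega> :: "bits set" and a :: bool and s :: nat and \<beta> :: bits
    and v :: "nat \<Rightarrow> 'a::field bvec"
  assumes C1: "C1 \<Omega>"
    and mem: "replicate s a @ \<beta> \<in> \<Omega>"
    and alt: "\<And>j. j < length \<beta> \<Longrightarrow> \<beta> ! j = (even j = a)"
    and walk: "walk a \<Omega> v (length \<beta> + 2)"
    and zero: "\<And>w. w \<in> \<Omega> \<Longrightarrow> v 0 (Some w) = 0"
begin

lemma prefix_word_mem: "replicate s a @ take j \<beta> \<in> \<Omega>"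
  using mem prefix_in_if_C1[OF C1, of "replicate s a @ take j \<beta>" "drop j \<beta>"] by simp

lemma prefix_word_Suc:
  "j < length \<beta> \<Longrightarrow>
     replicate s a @ take (Suc j) \<beta> = (replicate s a @ take j \<beta>) @ [even j = a]"
  by (simp add: take_Suc_conv_app_nth alt)

lemma prefix_word_recurrence:
  assumes "j < length \<beta>" "i \<le> length \<beta>" "even i \<noteq> even j"
  shows "v (Suc (Suc i)) (Some (replicate s a @ take (Suc j) \<beta>))
         = v i (Some (replicate s a @ take (Suc j) \<beta>))
           + (v (Suc (Suc i)) None - v i None) * v (Suc i) (Some (replicate s a @ take j \<beta>))"
proof -
  have "(even j = a) = (even i \<noteq> a)" using assms(3) by auto
  then show ?thesis
    using two_steps_same[OF walk, of i "even j = a" "replicate s a @ take j \<beta>"]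
      prefix_word_mem[of "Suc j"] assms(2)
    unfolding prefix_word_Suc[OF assms(1)] by (simp add: diff_eq_eq add.commute)
qed

text \<open>
  An entry that is zero at the start can become nonzero only one bit per edge; up to the \<open>j\<close>-th vertex
  the entry at the word with \<open>j\<close> bits of \<open>\<beta>\<close> is still out of reach.
\<close>

lemma walk_prefix_word_zero:
  assumes "i \<le> j" "j \<le> length \<beta>" "even i = even j"
  shows "v i (Some (replicate s a @ take j \<beta>)) = 0"
  using assms
proof (induction i arbitrary: j rule: induct_nat_012)
  case 0
  show ?case using zero prefix_word_mem by simp
next
  case 1
  then obtain k where k: "j = Suc k" "even k" by (cases j) auto
  then have word: "replicate s a @ take j \<beta> = (replicate s a @ take k \<beta>) @ [a]"
    using prefix_word_Suc[of k] 1 by simp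
  have "adj a \<Omega> (v 0) (v 1)" using walk by (auto simp: walk_def)
  then have "v 0 (Some (replicate s a @ take j \<beta>)) + v 1 (Some (replicate s a @ take j \<beta>))
      = v 1 None * v 0 (Some (replicate s a @ take k \<beta>))"
    using prefix_word_mem[of j] unfolding word adj_def by blast
  then show ?case using zero[OF prefix_word_mem[of j]] zero[OF prefix_word_mem[of k]] by simp
next
  case (ge2 i)
  then obtain k where k: "j = Suc k" by (cases j) auto
  have "v i (Some (replicate s a @ take (Suc k) \<beta>)) = 0"
    using ge2 k by auto
  moreover have "v (Suc i) (Some (replicate s a @ take k \<beta>)) = 0"
    using ge2 k by auto
  ultimately show ?case
    using prefix_word_recurrence[of k i] ge2 k by simp
qed

lemma walk_prefix_word:
  assumes "j \<le> length \<beta>"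
  shows "v (j + 2) (Some (replicate s a @ take j \<beta>))
         = v 1 None ^ Suc s * (\<Prod>i\<le>j. v (i + 2) None - v i None)"
  using assms
proof (induction j)
  case 0
  show ?case
    using walk_constant_word[OF C1 walk, of s] prefix_word_mem[of 0] zero by (simp add: numeral_2_eq_2)
next
  case (Suc j)
  have "v (Suc j) (Some (replicate s a @ take (Suc j) \<beta>)) = 0"
    using walk_prefix_word_zero Suc.prems by simp
  then show ?case
    using prefix_word_recurrence[of j "Suc j"] Suc by (simp add: mult_ac)
qed

end

section \<open>Finite fields\<close>

text \<open>
  Multiplication by \<open>z\<close> permutes the nonzero elements, hence fixes their product.
\<close>

lemma finite_field_power_card:
  fixes z :: "'a::{field,finite}"
  assumes "z \<noteq> 0"
  shows "z ^ (CARD('a) - 1) = 1"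
proof -
  let ?U = "UNIV - {0 :: 'a}"
  have "(\<Prod>x\<in>?U. x) = (\<Prod>x\<in>?U. z * x)"
    by (rule prod.reindex_bij_witness[of _ "\<lambda>x. z * x" "\<lambda>x. x / z"]) (use assms in auto)
  also have "\<dots> = z ^ card ?U * (\<Prod>x\<in>?U. x)"
    by (simp add: prod.distrib)
  finally have "z ^ card ?U = 1"
    by simp
  then show ?thesis by (simp add: card_Diff_singleton)
qed

lemma eq_one_if_coprime_powers:
  fixes z :: "'a::{field,finite}"
  assumes "z \<noteq> 0" "z ^ Suc s = z ^ Suc t" "gcd (int s - int t) (int CARD('a) - 1) = 1"
  shows "z = 1"
proof -
  obtain g h where gh: "g * (int s - int t) + h * (int CARD('a) - 1) = 1"
    using bezout_int[of "int s - int t" "int CARD('a) - 1"] assms(3) by metis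
  have "z ^ s = z ^ t" using assms(1,2) by simp
  then have 1: "z powi (int s - int t) = 1"
    using assms(1) by (simp add: power_int_diff)
  have "int CARD('a) - 1 = int (CARD('a) - 1)"
    using zero_less_card_finite[where 'a = 'a] by linarith
  then have 2: "z powi (int CARD('a) - 1) = 1"
    using finite_field_power_card[OF assms(1)] by (simp only: power_int_of_nat)
  have "z = z powi (g * (int s - int t) + h * (int CARD('a) - 1))"
    using gh by simp
  also have "\<dots> = (z powi (int s - int t)) powi g * (z powi (int CARD('a) - 1)) powi h"
    using assms(1) by (simp add: power_int_add mult.commute flip: power_int_mult)
  finally show ?thesis using 1 2 by simp
qed

lemma eq_if_proportional_powers:
  fixes x y P Q :: "'a::{field,finite}"
  assumes "x ^ Suc s * P = y ^ Suc s * Q" "x ^ Suc t * P = y ^ Suc t * Q" "P \<noteq> 0" "Q \<noteq> 0"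
    and "gcd (int s - int t) (int CARD('a) - 1) = 1"
  shows "x = y"
proof (cases "y = 0")
  case True
  then show ?thesis using assms(1,3) by auto
next
  case False
  then have "x \<noteq> 0" using assms(1,4) by auto
  have "(x / y) ^ Suc s = Q / P" "(x / y) ^ Suc t = Q / P"
    using assms(1-4) False unfolding power_divide by (simp_all add: frac_eq_eq mult.commute)
  then have "x / y = 1"
    using \<open>x \<noteq> 0\<close> False assms(5) by (intro eq_one_if_coprime_powers[of _ s t]) simp_all
  then show ?thesis using False by simp
qed

section \<open>Short closed walks\<close>

text \<open>
  The vertex opposite to the start is reached by \<open>length \<beta> + 2\<close> steps in either direction. Its
  entries at the two given words, computed both ways, force the two neighbours of the start to
  have the same colour.
\<close>

lemma closed_walk_backtracks:
  fixes v :: "nat \<Rightarrow> 'a::{field,finite} bvec"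
  assumes "finite \<Omega>" "C1 \<Omega>" "S_all \<Omega> \<subseteq> \<Omega>"
    and mem: "replicate s a @ \<beta> \<in> \<Omega>" "replicate t a @ \<beta> \<in> \<Omega>"
    and alt: "\<And>j. j < length \<beta> \<Longrightarrow> \<beta> ! j = (even j = a)"
    and gcd: "gcd (int s - int t) (int CARD('a) - 1) = 1"
    and n: "n = 2 * (length \<beta> + 2)"
    and walk: "walk a \<Omega> v n" and closed: "v n = v 0"
    and reduced: "\<And>i. i + 2 \<le> n \<Longrightarrow> v (i + 2) None \<noteq> v i None"
  shows "v 1 None = v (n - 1) None"
proof -
  obtain \<phi> where \<phi>: "\<And>b p. \<phi> b p None = p None"
    "\<And>b p q. adj b \<Omega> p q \<Longrightarrow> adj b \<Omega> (\<phi> b p) (\<phi> (\<not> b) q)"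
    "\<And>w. w \<in> \<Omega> \<Longrightarrow> \<phi> a (v 0) (Some w) = 0"
    using ex_normalizing_automorphism[OF assms(1,3), of a "v 0"] by blast
  define f where "f i = \<phi> (even i = a) (v i)" for i
  have f_None: "f i None = v i None" for i
    by (simp add: f_def \<phi>(1))
  have f_walk: "walk a \<Omega> f n"
    unfolding walk_def
  proof (intro allI impI)
    fix i assume "i < n"
    then have "adj (even i = a) \<Omega> (v i) (v (Suc i))"
      using walk by (simp add: walk_def)
    moreover have "(even (Suc i) = a) = (\<not> (even i = a))" by auto
    ultimately show "adj (even i = a) \<Omega> (f i) (f (Suc i))"
      using \<phi>(2) unfolding f_def by (simp only:)
  qed
  define g where "g i = f (n - i)" for i
  have g_walk: "walk a \<Omega> g n"
    using walk_rev[OF f_walk] n by (simp add: g_def[abs_def])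
  have zero: "f 0 (Some w) = 0" "g 0 (Some w) = 0" if "w \<in> \<Omega>" for w
    using \<phi>(3)[OF that] closed n by (simp_all add: f_def g_def)
  define P where "P = (\<Prod>i\<le>length \<beta>. f (i + 2) None - f i None)"
  define Q where "Q = (\<Prod>i\<le>length \<beta>. g (i + 2) None - g i None)"
  have half: "f (length \<beta> + 2) = g (length \<beta> + 2)"
    by (simp add: g_def n)
  have sub: "walk a \<Omega> h (length \<beta> + 2)" if "walk a \<Omega> h n" for h :: "nat \<Rightarrow> 'a bvec"
    using that n by (simp add: walk_def)
  have eq: "f 1 None ^ Suc r * P = g 1 None ^ Suc r * Q" if "replicate r a @ \<beta> \<in> \<Omega>" for r
    using walk_prefix_word[OF assms(2) that alt sub[OF f_walk] zero(1), of "length \<beta>"]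
      walk_prefix_word[OF assms(2) that alt sub[OF g_walk] zero(2), of "length \<beta>"] half
    by (simp add: P_def Q_def)
  have "P \<noteq> 0"
    using reduced n by (simp add: P_def f_None)
  moreover have "Q \<noteq> 0"
  proof -
    have "g (i + 2) None \<noteq> g i None" if "i \<le> length \<beta>" for i
      using reduced[of "n - (i + 2)"] that n by (simp add: g_def f_None Suc_diff_le)
    then show ?thesis
      by (simp add: Q_def)
  qed
  ultimately have "f 1 None = g 1 None"
    using eq_if_proportional_powers[OF eq[OF mem(1)] eq[OF mem(2)]] gcd by blast
  then show ?thesis by (simp add: f_None g_def)
qed

section \<open>Cycles of the graph\<close>

definition side :: "'a vertex \<Rightarrow> bool" where
  "side x = (\<not> isl x)"

definition vec :: "'a vertex \<Rightarrow> 'a bvec" where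
  "vec x = (case x of Inl l \<Rightarrow> l | Inr r \<Rightarrow> r)"

lemma vertex_eqI: "side x = side y \<Longrightarrow> vec x = vec y \<Longrightarrow> x = y"
  by (cases x; cases y) (auto simp: side_def vec_def)

lemma Gamma_arcD:
  assumes "(x, y) \<in> parcs (Gamma \<Omega>)"
  shows "side y = (\<not> side x)" "adj (side x) \<Omega> (vec x) (vec y)" "vec x \<in> vecs \<Omega>" "vec y \<in> vecs \<Omega>"
  using assms
  by (auto simp: Gamma_def side_def vec_def adj_False adj_swap[of False, simplified])

lemma Gamma_neighbours_eq:
  assumes "C1 \<Omega>" "(x, y) \<in> parcs (Gamma \<Omega>)" "(y, z) \<in> parcs (Gamma \<Omega>)" "vec x None = vec z None"
  shows "x = z"
proof (rule vertex_eqI)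
  note xy = Gamma_arcD[OF assms(2)] and yz = Gamma_arcD[OF assms(3)]
  show "side x = side z" using xy(1) yz(1) by simp
  have "adj (side y) \<Omega> (vec y) (vec x)"
    using xy(1,2) adj_swap[of "side x" \<Omega> "vec y" "vec x"] by simp
  note determined = neighbour_determined_by_colour[OF assms(1) this yz(2) assms(4)]
  have *: "vec x (Some w) = vec z (Some w)" if "w \<in> \<Omega>" for w
    using determined[OF that] .
  show "vec x = vec z"
  proof (rule PiE_ext)
    show "vec x \<in> idx \<Omega> \<rightarrow>\<^sub>E UNIV" "vec z \<in> idx \<Omega> \<rightarrow>\<^sub>E UNIV"
      using xy(3) yz(4) by (simp_all add: vecs_def)
  qed (use * assms(4) in \<open>auto simp: idx_def\<close>)
qed

lemma (in pre_digraph) cas_nth: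
  "cas u p v \<Longrightarrow> Suc i < length p \<Longrightarrow> head G (p ! i) = tail G (p ! Suc i)"
proof (induction u p v arbitrary: i rule: cas.induct)
  case (2 u e es v)
  then show ?case by (cases i; cases es) auto
qed simp

text \<open>
  Continuing a cycle periodically makes every choice of starting vertex available.
\<close>

lemma cycle_imp_periodic:
  fixes G :: "'v pair_pre_digraph"
  assumes "pre_digraph.cycle (with_proj G) p"
  obtains W :: "nat \<Rightarrow> 'v" where
    "\<And>i. (W i, W (Suc i)) \<in> parcs G"
    "\<And>i j. W i = W j \<longleftrightarrow> i mod length p = j mod length p"
proof -
  let ?n = "length p"
  interpret pre_digraph "with_proj G" .
  obtain u where u: "awalk u p u" "distinct (tl (awalk_verts u p))" "p \<noteq> []"
    using assms unfolding cycle_def by blast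
  then have cas: "cas u p u" and arcs: "set p \<subseteq> parcs G"
    by (auto simp: awalk_def)
  have distinct: "distinct (map snd p)"
    using u(2,3) awalk_verts_conv'[OF cas] by simp
  have last: "snd (last p) = u"
  proof -
    have "cas x q y \<Longrightarrow> last (awalk_verts x q) = y" for x q y
      by (induction q arbitrary: x) auto
    then have "last (awalk_verts u p) = u"
      using cas .
    then show ?thesis using u(3) by (simp add: awalk_verts_conv)
  qed
  define W where "W i = snd (p ! (i mod ?n))" for i
  have succ: "W i = fst (p ! (Suc i mod ?n))" for i
  proof (cases "Suc (i mod ?n) = ?n")
    case True
    then have "Suc i mod ?n = 0" "i mod ?n = ?n - 1" by (auto simp: mod_Suc)
    then show ?thesis
      using last cas_simp[OF u(3)] cas u(3) by (simp add: W_def last_conv_nth hd_conv_nth)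
  next
    case False
    then have "Suc (i mod ?n) < ?n" "Suc i mod ?n = Suc (i mod ?n)"
      using u(3) by (auto simp: mod_Suc intro: Suc_lessI)
    then show ?thesis using cas_nth[OF cas] by (simp add: W_def)
  qed
  show ?thesis
  proof
    fix i
    have "p ! (Suc i mod ?n) \<in> set p" using u(3) by simp
    then show "(W i, W (Suc i)) \<in> parcs G"
      using arcs succ[of i] by (auto simp: W_def)
  next
    fix i j
    show "W i = W j \<longleftrightarrow> i mod ?n = j mod ?n"
      using nth_eq_iff_index_eq[OF distinct, of "i mod ?n" "j mod ?n"] u(3) by (simp add: W_def)
  qed
qed

lemma nth_M:
  assumes "\<beta> \<in> M a \<union> {[]}" "j < length \<beta>"
  shows "\<beta> ! j = (even j = a)"
  using assms(2)
proof (induction j)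
  case 0
  then show ?case using assms(1) by (auto simp: M_def hd_conv_nth)
next
  case (Suc j)
  have "distinct_adj \<beta>" using assms(1) Suc.prems by (auto simp: M_def)
  then have "\<beta> ! j \<noteq> \<beta> ! Suc j"
    using Suc.prems by (simp add: distinct_adj_conv_nth)
  then show ?case using Suc by auto
qed

theorem theorem9:
  fixes \<Omega> :: "bits set" and a :: bool and \<beta> :: bits and s t :: nat
  assumes "finite \<Omega>" and "C1 \<Omega>"
    and "S_all \<Omega> \<subseteq> \<Omega>"
    and "\<beta> \<in> M a \<union> {[]}"
    and "{replicate s a @ \<beta>, replicate t a @ \<beta>} \<subseteq> \<Omega>"
    and "gcd (int s - int t) (int CARD('a) - 1) = 1"
  shows "girth (Gamma \<Omega> :: 'a::{field,finite} vertex pair_pre_digraph) \<ge> enat (2 * (length \<beta> + 3))"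
proof -
  have "2 * (length \<beta> + 3) \<le> length p"
    if cycle: "pre_digraph.cycle (with_proj (Gamma \<Omega> :: 'a vertex pair_pre_digraph)) p"
      and n3: "3 \<le> length p" for p
  proof (rule ccontr)
    assume short: "\<not> 2 * (length \<beta> + 3) \<le> length p"
    define n where "n = length p"
    obtain W :: "nat \<Rightarrow> 'a vertex" where arc: "\<And>i. (W i, W (Suc i)) \<in> parcs (Gamma \<Omega>)"
      and W_eq: "\<And>i j. W i = W j \<longleftrightarrow> i mod n = j mod n"
      using cycle_imp_periodic[OF cycle] unfolding n_def by blast
    \<comment> \<open>The sides alternate, so one of the first two vertices can serve as starting point.\<close>
    define d where "d = (if side (W 0) = a then 0 else 1 :: nat)"
    have alternate: "side (W (Suc i)) = (\<not> side (W i))" for i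
      using Gamma_arcD(1)[OF arc] .
    have "side (W d) = a"
      using alternate[of 0] by (simp add: d_def)
    then have side: "side (W (d + i)) = (even i = a)" for i
      using alternate by (induction i) auto
    have "W (d + n) = W (d + 0)" by (simp add: W_eq)
    then have "even n"
      using side[of n] side[of 0] by auto
    then obtain m where m: "n = 2 * m" by blast
    have m2: "2 \<le> m" "m \<le> length \<beta> + 2"
      using n3 short m n_def by auto
    define v where "v i = vec (W (d + i))" for i
    have walk: "walk a \<Omega> v n"
      unfolding walk_def v_def 
      using Gamma_arcD(2)[OF arc[of "d + _"]] by (simp add: side)
    have two_apart: "W i \<noteq> W (i + 2)" for i
    proof -
      have "W i = W (i + 2) \<longleftrightarrow> n dvd 2"
        unfolding W_eq using mod_eq_dvd_iff_nat[of i "i + 2" n] by auto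
      then show ?thesis using n3 n_def by (auto dest: dvd_imp_le)
    qed
    have colours: "vec (W i) None \<noteq> vec (W (i + 2)) None" for i
      using Gamma_neighbours_eq[OF assms(2) arc arc] two_apart by (metis add_2_eq_Suc')
    \<comment> \<open>The argument needs the word to fit the length of the cycle exactly.\<close>
    define \<gamma> where "\<gamma> = take (m - 2) \<beta>"
    have len: "length \<gamma> = m - 2" using m2 by (simp add: \<gamma>_def)
    have mem: "replicate r a @ \<gamma> \<in> \<Omega>" if "replicate r a @ \<beta> \<in> \<Omega>" for r
      using that prefix_in_if_C1[OF assms(2), of "replicate r a @ \<gamma>" "drop (m - 2) \<beta>"]
      by (simp add: \<gamma>_def)
    have "v 1 None = v (n - 1) None"
    proof (rule closed_walk_backtracks[OF assms(1-3) mem mem _ assms(6) _ walk])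
      show "replicate s a @ \<beta> \<in> \<Omega>" "replicate t a @ \<beta> \<in> \<Omega>" using assms(5) by auto
      show "\<gamma> ! j = (even j = a)" if "j < length \<gamma>" for j
        using that nth_M[OF assms(4)] by (simp add: \<gamma>_def)
      show "n = 2 * (length \<gamma> + 2)" using len m m2 by simp
      show "v n = v 0" using \<open>W (d + n) = W (d + 0)\<close> by (simp add: v_def)
      show "v (i + 2) None \<noteq> v i None" for i
        using colours[of "d + i"] by (simp add: v_def add.assoc)
    qed
    moreover have "W (d + (n - 1) + 2) = W (d + 1)"
    proof -
      have "d + (n - 1) + 2 = (d + 1) + n" using m m2 by simp
      then show ?thesis unfolding W_eq by (simp only: mod_add_self2)
    qed
    ultimately show False
      using colours[of "d + (n - 1)"] by (simp add: v_def)
  qed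
  then show ?thesis
    unfolding girth_def by (intro INF_greatest) auto
qed

end
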